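(* Let $\mathcal G$ be a connected unweighted graph on $n\ge2$ nodes with adjacency matrix $A_{\mathcal G}$, and let $\|A_{\mathcal G}\|_0$ be the number of nonzero entries of $A_{\mathcal G}$. Then $$\rho_{ss}(L_{\mathcal G};M_n)\,\|A_{\mathcal G}\|_0\ \ge\ \frac{(n-1)^2}2$$ and $$\frac{\rho_{ss}(L_{\mathcal G};M_n)-\frac12+\frac1{2n}}{\mathrm{diam}(\mathcal G)}+\frac{\|A_{\mathcal G}\|_0}{4(n-1)}\ \le\ \frac n4,$$ where $\mathrm{diam}(\mathcal G)$ is the diameter of $\mathcal G$.
   Context: Graphs are finite, simple, undirected. The diameter is the largest distance between pairs of nodes. $L_{\mathcal G}$ is the graph Laplacian (degree matrix minus adjacency matrix) with eigenvalues $0=\lambda_1<\lambda_2\le\dots\le\lambda_n$, $M_n=I_n-\frac1nJ_n$ is the centering matrix, and $\rho_{ss}(L_{\mathcal G};M_n)=\frac12\sum_{i=2}^n\lambda_i^{-1}$ is the performance measure of the first-order consensus network $\dot x=-L_{\mathcal G}x+\xi$, $y=M_nx$. *)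

theory Defs
  imports
    "Graph_Theory.Graph_Theory"
    "Jordan_Normal_Form.Char_Poly"
begin

text \<open>
  Simple undirected graphs are the library's \<^locale>\<open>graph\<close>s: finite, symmetric, loop-free
  digraphs without parallel arcs. Matrices are indexed by positions in a list \<open>vs\<close> that
  enumerates the nodes without repetition.
\<close>

definition adjacency_mat :: "('a, 'b) pre_digraph \<Rightarrow> 'a list \<Rightarrow> real mat" where
  "adjacency_mat G vs =
     mat (length vs) (length vs) (\<lambda>(i, j). if vs ! i \<rightarrow>\<^bsub>G\<^esub> vs ! j then 1 else 0)"

text \<open>In a symmetric digraph every edge at a node contributes exactly one outgoing arc.\<close>

definition degree_mat :: "('a, 'b) pre_digraph \<Rightarrow> 'a list \<Rightarrow> real mat" where
  "degree_mat G vs =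
     mat (length vs) (length vs) (\<lambda>(i, j). if i = j then real (out_degree G (vs ! i)) else 0)"

definition laplacian_mat :: "('a, 'b) pre_digraph \<Rightarrow> 'a list \<Rightarrow> real mat" where
  "laplacian_mat G vs = degree_mat G vs - adjacency_mat G vs"

definition num_nonzero_entries :: "'c::zero mat \<Rightarrow> nat" where
  "num_nonzero_entries A =
     card {(i, j). i < dim_row A \<and> j < dim_col A \<and> A $$ (i, j) \<noteq> 0}"

text \<open>
  The real eigenvalues with algebraic multiplicity, in ascending order. For a symmetric matrix
  these are all its eigenvalues, so the list then has as many entries as the matrix has rows.
\<close>

definition sorted_eigenvalues :: "real mat \<Rightarrow> real list" where
  "sorted_eigenvalues A = sorted_list_of_multiset (proots (char_poly A))"

text \<open>
  The performance measure of the consensus network with state matrix \<open>- L\<close> and the centering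
  matrix as output matrix. Lists are indexed from \<open>0\<close>, so the smallest eigenvalue, which is
  \<open>0\<close> for a Laplacian, is the one left out of the sum.
\<close>

definition rho_ss_centered :: "real mat \<Rightarrow> real" where
  "rho_ss_centered L = 1 / 2 * (\<Sum>i = 1..<dim_row L. 1 / sorted_eigenvalues L ! i)"

definition graph_distance :: "('a, 'b) pre_digraph \<Rightarrow> 'a \<Rightarrow> 'a \<Rightarrow> ereal" where
  "graph_distance G u v = wf_digraph.\<mu> G (\<lambda>_. 1) u v"

text \<open>
  Distances are finite in a connected graph, so there the conversion to \<^typ>\<open>real\<close> is harmless.
\<close>

definition diameter :: "('a, 'b) pre_digraph \<Rightarrow> real" where
  "diameter G =
     real_of_ereal (Max ((\<lambda>(u, v). graph_distance G u v) ` (verts G \<times> verts G)))"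

end

theory Submission
  imports Defs "Jordan_Normal_Form.Schur_Decomposition"
begin

text \<open>
  Write \<open>L\<close> for the Laplacian, \<open>\<lambda>\<close> for its nonzero eigenvalues, \<open>W\<close> for the number of nonzero
  adjacency entries (twice the number of edges) and \<open>\<rho>\<close> for half the sum of the \<open>1 / \<lambda>\<close>.

  The first inequality is Cauchy--Schwarz: the eigenvalues sum to the trace of \<open>L\<close>, which is the sum
  \<open>W\<close> of the degrees, so \<open>2 \<rho> W\<close> is the product of the sum of the \<open>\<lambda>\<close> and the sum of their
  reciprocals, and there are \<open>n - 1\<close> of them.

  The second inequality comes from regarding the graph as an electrical network with unit resistors.
  The matrix \<open>K = L + J / n\<close>, with \<open>J\<close> the all-ones matrix, moves the eigenvalue \<open>0\<close> of the
  constant vectors to \<open>1\<close> and keeps the other ones, so it is invertible, and the inverse \<open>M\<close> has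
  trace \<open>1 + 2 \<rho>\<close>. The effective resistance of two nodes is
  \<open>r i j = M\<^sub>i\<^sub>i - M\<^sub>i\<^sub>j - M\<^sub>j\<^sub>i + M\<^sub>j\<^sub>j\<close>. Over ordered pairs,
  \<^item> all resistances add up to \<open>2 n (trace M - 1) = 4 n \<rho>\<close> (\<open>sum_resistance\<close>),
  \<^item> those of adjacent nodes add up to \<open>2 (n - 1)\<close>, which is Foster's theorem
    (\<open>sum_adjacent_resistance\<close>),
  \<^item> every single one is at most the length of a path joining the two nodes, hence at most the
    diameter \<open>d\<close> (\<open>resistance_le_path_length\<close>).
  There are \<open>n (n - 1) - W\<close> ordered pairs of distinct nonadjacent nodes, so
  \<open>4 n \<rho> - 2 (n - 1) \<le> d (n (n - 1) - W)\<close>. Dividing by \<open>4 n d\<close> and weakening the denominator \<open>n\<close> on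
  the right to \<open>n - 1\<close> gives the claim.

  The spectrum is handled through characteristic polynomials and traces rather than through an
  orthonormal basis of eigenvectors: reality and positivity of the eigenvalues of \<open>K\<close> follow from
  the energy form evaluated at a complex eigenvector, and traces are sums of roots.
\<close>

section \<open>Traces and characteristic polynomials\<close>

definition mat_trace :: "'a :: comm_monoid_add mat \<Rightarrow> 'a" where
  "mat_trace A = (\<Sum>i<dim_row A. A $$ (i, i))"

lemma mat_trace_mult_commute:
  fixes A B :: "'a :: comm_semiring_0 mat"
  assumes "A \<in> carrier_mat n m" "B \<in> carrier_mat m n"
  shows "mat_trace (A * B) = mat_trace (B * A)"
proof -
  have "mat_trace (A * B) = (\<Sum>i<n. \<Sum>j<m. A $$ (i, j) * B $$ (j, i))"
    using assms by (auto simp: mat_trace_def scalar_prod_def atLeast0LessThan)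
  also have "\<dots> = (\<Sum>j<m. \<Sum>i<n. B $$ (j, i) * A $$ (i, j))"
    by (subst sum.swap) (simp add: mult.commute)
  also have "\<dots> = mat_trace (B * A)"
    using assms by (auto simp: mat_trace_def scalar_prod_def atLeast0LessThan)
  finally show ?thesis .
qed

text \<open>
  A matrix whose characteristic polynomial splits is similar to a triangular one with the roots on
  the diagonal, and the trace is invariant under similarity.
\<close>

lemma mat_trace_eq_sum_list_roots:
  fixes A :: "'a :: conjugatable_ordered_field mat"
  assumes A: "A \<in> carrier_mat n n"
    and cp: "char_poly A = (\<Prod>e\<leftarrow>es. [:- e, 1:])"
  shows "mat_trace A = sum_list es"
proof -
  obtain B P Q where sd: "schur_decomposition A es = (B, P, Q)"
    by (cases "schur_decomposition A es") auto
  from schur_decomposition[OF A cp sd]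
  have wit: "similar_mat_wit A B P Q" and diag: "diag_mat B = es" by auto
  note w = similar_mat_witD2[OF A wit]
  have B: "B \<in> carrier_mat n n" and P: "P \<in> carrier_mat n n" and Q: "Q \<in> carrier_mat n n"
    and QP: "Q * P = 1\<^sub>m n" and APBQ: "A = P * B * Q"
    using w by auto
  have "mat_trace A = mat_trace (Q * (P * B))"
    unfolding APBQ using P B Q by (intro mat_trace_mult_commute) auto
  also have "Q * (P * B) = B"
    using P B Q QP by (simp flip: assoc_mult_mat[of Q n n P n B n])
  also have "mat_trace B = sum_list (diag_mat B)"
    by (simp add: mat_trace_def diag_mat_def sum_list_sum_nth atLeast0LessThan)
  finally show ?thesis using diag by simp
qed

lemma poly_char_poly:
  fixes A :: "'a :: field mat"
  assumes A: "A \<in> carrier_mat n n"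
  shows "poly (char_poly A) x = det (x \<cdot>\<^sub>m 1\<^sub>m n - A)"
proof -
  have "- char_matrix A x = x \<cdot>\<^sub>m 1\<^sub>m n - A"
    using A by (intro eq_matI) (auto simp: char_matrix_def)
  thus ?thesis using char_poly_matrix[OF A, of x] by simp
qed

lemma poly_linear_factors:
  "poly (\<Prod>e\<leftarrow>es. [:- e, 1:]) (x :: 'a :: comm_ring_1) = (\<Prod>e\<leftarrow>es. x - e)"
  by (induction es) (auto simp: algebra_simps)

lemma prod_list_reciprocal_factors:
  fixes x :: "'a :: field"
  assumes "x \<noteq> 0" "0 \<notin> set es"
  shows "x ^ length es * (\<Prod>e\<leftarrow>es. 1 / x - e)
         = (\<Prod>e\<leftarrow>es. - e) * (\<Prod>e\<leftarrow>es. x - 1 / e)"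
  using assms(2)
proof (induction es)
  case (Cons e es)
  have "x ^ length (e # es) * (\<Prod>e\<leftarrow>e # es. 1 / x - e)
      = (x * (1 / x - e)) * (x ^ length es * (\<Prod>e\<leftarrow>es. 1 / x - e))"
    by (simp only: list.map prod_list.Cons length_Cons power_Suc mult_ac)
  also have "x * (1 / x - e) = - e * (x - 1 / e)"
    using Cons.prems assms(1) by (simp add: field_simps)
  also have "x ^ length es * (\<Prod>e\<leftarrow>es. 1 / x - e) = (\<Prod>e\<leftarrow>es. - e) * (\<Prod>e\<leftarrow>es. x - 1 / e)"
    using Cons by simp
  finally show ?case
    by (simp only: list.map prod_list.Cons mult_ac)
qed auto

text \<open>
  From \<open>x I - B = x (- B) (1 / x I - A)\<close> with \<open>B\<close> inverse to \<open>A\<close>, the characteristic polynomial of \<open>B\<close>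
  at \<open>x\<close> is, up to a factor, the reversed characteristic polynomial of \<open>A\<close>. Both sides being monic
  settles the factor without computing any determinant.
\<close>

lemma char_poly_inverse:
  fixes A :: "'a :: field_char_0 mat"
  assumes A: "A \<in> carrier_mat n n" and B: "B \<in> carrier_mat n n" and AB: "A * B = 1\<^sub>m n"
    and cp: "char_poly A = (\<Prod>e\<leftarrow>es. [:- e, 1:])" and nz: "0 \<notin> set es"
  shows "char_poly B = (\<Prod>e\<leftarrow>es. [:- (1 / e), 1:])"
proof -
  define c where "c = det (- B) * (\<Prod>e\<leftarrow>es. - e)"
  let ?q = "\<Prod>e\<leftarrow>es. [:- (1 / e), 1:]"
  have len: "length es = n"
    using degree_monic_char_poly[OF A] degree_linear_factors[of uminus es] cp by simp
  have pq: "poly ?q x = (\<Prod>e\<leftarrow>es. x - 1 / e)" for x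
    using poly_linear_factors[of "map (\<lambda>e. 1 / e) es" x] by (simp add: o_def)
  have key: "poly (char_poly B) x = c * poly ?q x" if x: "x \<noteq> 0" for x
  proof -
    have 1: "(- B) * ((1 / x) \<cdot>\<^sub>m 1\<^sub>m n - A) = 1\<^sub>m n - (1 / x) \<cdot>\<^sub>m B"
    proof -
      have BA: "B * A = 1\<^sub>m n" using mat_mult_left_right_inverse[OF A B AB] .
      have "(- B) * ((1 / x) \<cdot>\<^sub>m 1\<^sub>m n - A) = - (B * ((1 / x) \<cdot>\<^sub>m 1\<^sub>m n - A))"
        using A B by (intro uminus_mult_left_mat) auto
      also have "B * ((1 / x) \<cdot>\<^sub>m 1\<^sub>m n - A) = B * ((1 / x) \<cdot>\<^sub>m 1\<^sub>m n) - B * A"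
        using A B by (intro mult_minus_distrib_mat) auto
      also have "B * ((1 / x) \<cdot>\<^sub>m 1\<^sub>m n) = (1 / x) \<cdot>\<^sub>m B"
        using B by (subst mult_smult_distrib[of B n n _ n]) auto
      also have "- ((1 / x) \<cdot>\<^sub>m B - B * A) = 1\<^sub>m n - (1 / x) \<cdot>\<^sub>m B"
        unfolding BA using B by (intro eq_matI) auto
      finally show ?thesis .
    qed
    have "x \<cdot>\<^sub>m 1\<^sub>m n - B = x \<cdot>\<^sub>m ((- B) * ((1 / x) \<cdot>\<^sub>m 1\<^sub>m n - A))"
      unfolding 1 using B x by (intro eq_matI) (auto simp: field_simps)
    hence "poly (char_poly B) x = x ^ n * det ((- B) * ((1 / x) \<cdot>\<^sub>m 1\<^sub>m n - A))"
      using poly_char_poly[OF B, of x] A B by simp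
    also have "\<dots> = x ^ n * (det (- B) * poly (char_poly A) (1 / x))"
      using A B by (subst det_mult[of _ n]) (auto simp: poly_char_poly)
    also have "\<dots> = det (- B) * (x ^ length es * (\<Prod>e\<leftarrow>es. 1 / x - e))"
      by (simp add: cp poly_linear_factors len)
    also have "\<dots> = c * poly ?q x"
      using prod_list_reciprocal_factors[OF x nz] by (simp add: c_def pq)
    finally show ?thesis .
  qed
  \<comment> \<open>Multiplying by the indeterminate covers the point 0, where the reciprocal is not available.\<close>
  have "poly ([:0, 1:] * char_poly B) x = poly ([:0, 1:] * Polynomial.smult c ?q) x" for x
    using key[of x] by (cases "x = 0") auto
  hence "[:0, 1:] * char_poly B = [:0, 1:] * Polynomial.smult c ?q"
    by (simp add: poly_eq_poly_eq_iff[symmetric] fun_eq_iff)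
  hence eq: "char_poly B = Polynomial.smult c ?q" by (subst (asm) mult_left_cancel) auto
  have "lead_coeff ?q = 1"
  proof (induction es)
    case (Cons e es)
    have "lead_coeff ([:- (1 / e), 1:] * (\<Prod>e\<leftarrow>es. [:- (1 / e), 1:])) = 1"
      by (subst lead_coeff_mult) (simp add: Cons.IH)
    thus ?case by simp
  qed simp
  moreover have "lead_coeff (char_poly B) = 1"
    using degree_monic_char_poly[OF B] by simp
  ultimately have "c = 1" unfolding eq lead_coeff_smult by simp
  thus ?thesis using eq by simp
qed

text \<open>
  Sylvester's determinant identity: the block matrix with diagonal blocks \<open>1\<close> and off-diagonal
  blocks \<open>B\<close> and \<open>C\<close> can be made block triangular by eliminating either \<open>B\<close> or \<open>C\<close>.
\<close>

lemma det_one_minus_mult_commute: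
  fixes B C :: "'a :: idom mat"
  assumes B: "B \<in> carrier_mat n m" and C: "C \<in> carrier_mat m n"
  shows "det (1\<^sub>m n - B * C) = det (1\<^sub>m m - C * B)"
proof -
  let ?M = "four_block_mat (1\<^sub>m n) B C (1\<^sub>m m)"
  let ?X = "four_block_mat (1\<^sub>m n) (- B) (0\<^sub>m m n) (1\<^sub>m m)"
  let ?Y = "four_block_mat (1\<^sub>m n) (0\<^sub>m n m) (- C) (1\<^sub>m m)"
  have M: "?M \<in> carrier_mat (n + m) (n + m)" and X: "?X \<in> carrier_mat (n + m) (n + m)"
    and Y: "?Y \<in> carrier_mat (n + m) (n + m)" by auto
  have CB: "C * - B = - (C * B)" and BC: "B * - C = - (B * C)"
    using B C by auto
  note BC' = minus_carrier_mat[OF mult_carrier_mat[OF B C], of "1\<^sub>m n"]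
  note CB' = minus_carrier_mat[OF mult_carrier_mat[OF C B], of "1\<^sub>m m"]
  have MX: "?M * ?X = four_block_mat (1\<^sub>m n) (0\<^sub>m n m) C (1\<^sub>m m - C * B)"
    using B C by (subst mult_four_block_mat[of _ n n _ m _ m _ _ n _ m])
      (auto simp: CB intro!: arg_cong4[of _ _ _ _ _ _ _ _ four_block_mat])
  have MY: "?M * ?Y = four_block_mat (1\<^sub>m n - B * C) B (0\<^sub>m m n) (1\<^sub>m m)"
    using B C by (subst mult_four_block_mat[of _ n n _ m _ m _ _ n _ m])
      (auto simp: BC intro!: arg_cong4[of _ _ _ _ _ _ _ _ four_block_mat])
  have "det ?X = det (1\<^sub>m n :: 'a mat) * det (1\<^sub>m m :: 'a mat)"
    by (rule det_four_block_mat_lower_left_zero) (use B in auto)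
  moreover have "det ?Y = det (1\<^sub>m n :: 'a mat) * det (1\<^sub>m m :: 'a mat)"
    by (rule det_four_block_mat_upper_right_zero) (use C in auto)
  moreover have "det (?M * ?X) = det (1\<^sub>m n :: 'a mat) * det (1\<^sub>m m - C * B)"
    unfolding MX by (rule det_four_block_mat_upper_right_zero[OF one_carrier_mat refl C CB'])
  moreover have "det (?M * ?Y) = det (1\<^sub>m n - B * C) * det (1\<^sub>m m :: 'a mat)"
    unfolding MY by (rule det_four_block_mat_lower_left_zero[OF BC' B refl one_carrier_mat])
  ultimately show ?thesis
    unfolding det_mult[OF M X] det_mult[OF M Y] det_one by (metis mult_1 mult_1_right)
qed

text \<open>
  Adding the averaging matrix to a matrix that annihilates the constant vectors changes one
  eigenvalue from \<open>0\<close> to \<open>1\<close>. Since \<open>L J = 0\<close>, one has \<open>x I - K = (x I - L) (I - J / (n x))\<close>, and the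
  second factor, a rank-one perturbation of the identity, has determinant \<open>1 - 1 / x\<close>.
\<close>

lemma char_poly_add_averaging:
  fixes L :: "'a :: field_char_0 mat"
  assumes L: "L \<in> carrier_mat n n" and n: "n > 0"
    and rows: "\<And>i. i < n \<Longrightarrow> (\<Sum>j<n. L $$ (i, j)) = 0"
  defines "K \<equiv> L + mat n n (\<lambda>_. 1 / of_nat n)"
  shows "[:0, 1:] * char_poly K = [:- 1, 1:] * char_poly L"
proof -
  have K: "K \<in> carrier_mat n n" using L by (simp add: K_def)
  have key: "x * poly (char_poly K) x = (x - 1) * poly (char_poly L) x" if x: "x \<noteq> 0" for x
  proof -
    define B where "B = mat n 1 (\<lambda>_. 1 / (of_nat n * x))"
    define C where "C = mat 1 n (\<lambda>_. 1 :: 'a)"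
    have B: "B \<in> carrier_mat n 1" and C: "C \<in> carrier_mat 1 n" by (auto simp: B_def C_def)
    have BC: "B * C = mat n n (\<lambda>_. 1 / (of_nat n * x))"
      by (intro eq_matI) (auto simp: B_def C_def scalar_prod_def)
    have "(x \<cdot>\<^sub>m 1\<^sub>m n - L) * (1\<^sub>m n - B * C) = x \<cdot>\<^sub>m 1\<^sub>m n - K"
    proof (rule eq_matI)
      fix i j assume "i < dim_row (x \<cdot>\<^sub>m 1\<^sub>m n - K)" "j < dim_col (x \<cdot>\<^sub>m 1\<^sub>m n - K)"
      hence ij: "i < n" "j < n" using K by auto
      let ?t = "1 / (of_nat n * x)"
      have "((x \<cdot>\<^sub>m 1\<^sub>m n - L) * (1\<^sub>m n - B * C)) $$ (i, j)
          = (\<Sum>k<n. (x * of_bool (i = k) - L $$ (i, k)) * (of_bool (k = j) - ?t))"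
        using ij L by (auto simp: scalar_prod_def BC atLeast0LessThan intro!: sum.cong)
      also have "\<dots> = (\<Sum>k<n. if k = j then x * of_bool (i = j) - L $$ (i, j) else 0)
            - (\<Sum>k<n. if k = i then x * ?t else 0) + ?t * (\<Sum>k<n. L $$ (i, k))"
        unfolding sum_distrib_left sum.distrib[symmetric] sum_subtractf[symmetric]
        by (intro sum.cong refl) (auto simp: algebra_simps)
      also have "\<dots> = x * of_bool (i = j) - L $$ (i, j) - x * ?t"
        using ij rows[OF ij(1)] by simp
      also have "\<dots> = (x \<cdot>\<^sub>m 1\<^sub>m n - K) $$ (i, j)"
        using ij L x by (auto simp: K_def)
      finally show "((x \<cdot>\<^sub>m 1\<^sub>m n - L) * (1\<^sub>m n - B * C)) $$ (i, j) = (x \<cdot>\<^sub>m 1\<^sub>m n - K) $$ (i, j)" .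
    qed (use L K B C in auto)
    moreover note det_mult[OF minus_carrier_mat[OF L] minus_carrier_mat[OF mult_carrier_mat[OF B C]],
        of "x \<cdot>\<^sub>m 1\<^sub>m n" "1\<^sub>m n"]
    ultimately have "poly (char_poly K) x = poly (char_poly L) x * det (1\<^sub>m n - B * C)"
      by (simp only: poly_char_poly[OF K] poly_char_poly[OF L])
    also have "det (1\<^sub>m n - B * C) = det (1\<^sub>m 1 - C * B)"
      by (rule det_one_minus_mult_commute[OF B C])
    also have "\<dots> = 1 - 1 / x"
      using n x by (subst det_single) (auto simp: B_def C_def scalar_prod_def)
    finally show ?thesis using x by (simp add: field_simps)
  qed
  have "poly ([:0, 1:] * ([:0, 1:] * char_poly K)) x
      = poly ([:0, 1:] * ([:- 1, 1:] * char_poly L)) x" for x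
  proof (cases "x = 0")
    case False
    have "poly ([:0, 1:] * ([:0, 1:] * char_poly K)) x = x * (x * poly (char_poly K) x)"
      by simp
    also have "\<dots> = poly ([:0, 1:] * ([:- 1, 1:] * char_poly L)) x"
      unfolding key[OF False] by (simp add: algebra_simps)
    finally show ?thesis .
  qed simp
  hence "[:0, 1:] * ([:0, 1:] * char_poly K) = [:0, 1:] * ([:- 1, 1:] * char_poly L)"
    by (simp only: poly_eq_poly_eq_iff[symmetric] fun_eq_iff) blast
  thus ?thesis by (subst (asm) mult_left_cancel) auto
qed

section \<open>Laplacians of connected graphs\<close>

definition path_between :: "('v \<Rightarrow> 'v \<Rightarrow> bool) \<Rightarrow> 'v \<Rightarrow> 'v list \<Rightarrow> 'v \<Rightarrow> bool" where
  "path_between E u xs v \<longleftrightarrow>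
     xs \<noteq> [] \<and> hd xs = u \<and> last xs = v \<and> distinct xs \<and> successively E xs"

lemma sum_list_path_differences:
  fixes f :: "'v \<Rightarrow> 'a :: ab_group_add"
  assumes "xs \<noteq> []"
  shows "(\<Sum>(a, b)\<leftarrow>zip xs (tl xs). f a - f b) = f (hd xs) - f (last xs)"
  using assms by (induction xs rule: induct_list012) auto

lemma successively_imp_adjacent:
  "successively E xs \<Longrightarrow> (a, b) \<in> set (zip xs (tl xs)) \<Longrightarrow> E a b"
  by (induction xs rule: induct_list012) auto

lemma constant_along_path:
  assumes "path_between E u xs v" and "\<And>a b. E a b \<Longrightarrow> f a = f b"
  shows "f u = f v"
proof -
  have "xs \<noteq> [] \<Longrightarrow> successively E xs \<Longrightarrow> f (hd xs) = f (last xs)"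
  proof (induction xs rule: induct_list012)
    case (3 a b xs)
    hence "f b = f (last (b # xs))" and "E a b" by simp_all
    thus ?case using assms(2)[OF \<open>E a b\<close>] by simp
  qed simp_all
  thus ?thesis using assms(1) by (auto simp: path_between_def)
qed

text \<open>
  Nodes are the numbers below \<open>n\<close>, so that they double as matrix indices.
\<close>

locale connected_index_graph =
  fixes n :: nat and E :: "nat \<Rightarrow> nat \<Rightarrow> bool"
  assumes n_pos: "n > 0"
    and E_less: "E i j \<Longrightarrow> i < n"
    and E_sym: "E i j \<Longrightarrow> E j i"
    and E_irrefl: "\<not> E i i"
    and E_connected: "i < n \<Longrightarrow> j < n \<Longrightarrow> \<exists>xs. path_between E i xs j"
begin

lemma E_commute: "E i j \<longleftrightarrow> E j i"
  using E_sym by blast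

text \<open>
  The matrices below are needed over the reals and over the complex numbers, hence the polymorphism.
\<close>

definition adj :: "nat \<Rightarrow> nat \<Rightarrow> 'a :: zero_neq_one" where
  "adj i j = of_bool (E i j)"

lemma adj_commute: "adj i j = adj j i"
  by (simp add: adj_def E_commute[of i j])

lemma sum_adj_swap:
  fixes g :: "nat \<Rightarrow> nat \<Rightarrow> 'a :: comm_ring_1"
  shows "(\<Sum>i<n. \<Sum>j<n. adj i j * g i j) = (\<Sum>i<n. \<Sum>j<n. adj i j * g j i)"
  by (subst sum.swap) (simp add: adj_commute)

definition lap :: "'a :: comm_ring_1 mat" where
  "lap = mat n n (\<lambda>(i, j). (if i = j then \<Sum>k<n. adj i k else 0) - adj i j)"

lemma lap_carrier [simp]: "lap \<in> carrier_mat n n"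
  by (simp add: lap_def)

lemma lap_apply:
  fixes x :: "nat \<Rightarrow> 'a :: comm_ring_1"
  assumes "i < n"
  shows "(\<Sum>j<n. lap $$ (i, j) * x j) = (\<Sum>j<n. adj i j * (x i - x j))"
proof -
  have "(\<Sum>j<n. lap $$ (i, j) * x j)
      = (\<Sum>j<n. if j = i then (\<Sum>k<n. adj i k) * x i else 0) - (\<Sum>j<n. adj i j * x j)"
    unfolding sum_subtractf[symmetric] using assms
    by (intro sum.cong) (auto simp: lap_def algebra_simps)
  also have "\<dots> = (\<Sum>j<n. adj i j * (x i - x j))"
    using assms by (simp add: right_diff_distrib sum_subtractf flip: sum_distrib_right)
  finally show ?thesis .
qed

lemma lap_row_sum: "i < n \<Longrightarrow> (\<Sum>j<n. lap $$ (i, j)) = (0 :: 'a :: comm_ring_1)"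
  using lap_apply[of i "\<lambda>_. 1 :: 'a"] by simp

text \<open>
  The Laplacian as a Dirichlet form. It is stated bilinearly so that \<open>y = x\<close> gives the energy of a
  real potential and \<open>y = cnj x\<close> that of a complex one.
\<close>

lemma energy_identity:
  fixes x y :: "nat \<Rightarrow> 'a :: comm_ring_1"
  shows "2 * (\<Sum>i<n. y i * (\<Sum>j<n. lap $$ (i, j) * x j))
         = (\<Sum>i<n. \<Sum>j<n. adj i j * ((y i - y j) * (x i - x j)))"
proof -
  let ?S = "\<Sum>i<n. \<Sum>j<n. adj i j * (y i * (x i - x j))"
  have S: "(\<Sum>i<n. y i * (\<Sum>j<n. lap $$ (i, j) * x j)) = ?S"
    by (intro sum.cong refl, subst lap_apply) (auto simp: sum_distrib_left mult_ac)
  have "?S + ?S = ?S + (\<Sum>i<n. \<Sum>j<n. adj i j * (y j * (x j - x i)))"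
    by (subst sum_adj_swap[of "\<lambda>i j. y i * (x i - x j)"]) (rule refl)
  also have "\<dots> = (\<Sum>i<n. \<Sum>j<n. adj i j * (y i * (x i - x j)) + adj i j * (y j * (x j - x i)))"
    by (simp only: sum.distrib)
  also have "\<dots> = (\<Sum>i<n. \<Sum>j<n. adj i j * ((y i - y j) * (x i - x j)))"
  proof (intro sum.cong refl)
    fix i j
    show "adj i j * (y i * (x i - x j)) + adj i j * (y j * (x j - x i))
        = adj i j * ((y i - y j) * (x i - x j))"
      by (simp add: algebra_simps)
  qed
  finally show ?thesis unfolding S by (simp only: mult_2)
qed

text \<open>
  The matrix \<open>K = L + J / n\<close>: the averaging part makes the Laplacian of a connected graph invertible
  and leaves its action on vectors with sum \<open>0\<close> unchanged.
\<close>

definition reg_lap :: "'a :: field_char_0 mat" where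
  "reg_lap = lap + mat n n (\<lambda>_. 1 / of_nat n)"

lemma reg_lap_carrier [simp]: "reg_lap \<in> carrier_mat n n"
  by (simp add: reg_lap_def)

lemma reg_lap_entry:
  "i < n \<Longrightarrow> j < n \<Longrightarrow> reg_lap $$ (i, j) = lap $$ (i, j) + 1 / of_nat n"
  by (simp add: reg_lap_def)

lemma reg_lap_apply:
  assumes "i < n"
  shows "(\<Sum>j<n. reg_lap $$ (i, j) * x j)
         = (\<Sum>j<n. lap $$ (i, j) * x j) + (\<Sum>j<n. x j) / of_nat n"
  using assms by (simp add: reg_lap_entry distrib_right sum.distrib sum_divide_distrib)

lemma map_mat_of_real_reg_lap:
  "map_mat complex_of_real reg_lap = reg_lap"
  by (rule eq_matI) (auto simp: reg_lap_def lap_def adj_def)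

text \<open>
  For an eigenvector \<open>x\<close>, pairing \<open>K x = e x\<close> with \<open>cnj x\<close> expresses \<open>e\<close> as a quotient of nonnegative
  reals. The numerator cannot vanish: zero energy makes \<open>x\<close> constant along edges, so constant on the
  connected graph, and the averaging part then forces that constant to be \<open>0\<close>.
\<close>

lemma reg_lap_eigenvalue_pos:
  assumes "eigenvalue (reg_lap :: complex mat) e"
  shows "\<exists>r>0. e = complex_of_real r"
proof -
  obtain v where v: "v \<in> carrier_vec n" "v \<noteq> 0\<^sub>v n" and ev: "reg_lap *\<^sub>v v = e \<cdot>\<^sub>v v"
    using assms by (auto simp: eigenvalue_def eigenvector_def reg_lap_def)
  define x where "x i = v $ i" for i
  define s where "s = (\<Sum>j<n. x j)"
  define N where "N = (\<Sum>i<n. (cmod (x i))\<^sup>2)"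
  define Q where "Q = (\<Sum>i<n. \<Sum>j<n. adj i j * (cmod (x i - x j))\<^sup>2) + 2 * (cmod s)\<^sup>2 / n"
  have K: "(reg_lap :: complex mat) \<in> carrier_mat n n" by simp
  have row: "(\<Sum>j<n. reg_lap $$ (i, j) * x j) = e * x i" if "i < n" for i
  proof -
    have "(reg_lap *\<^sub>v v) $ i = e * x i" using that v(1) by (simp add: ev x_def)
    moreover have "(reg_lap *\<^sub>v v) $ i = (\<Sum>j<n. reg_lap $$ (i, j) * x j)"
      using that v(1) carrier_matD[OF K] by (simp add: scalar_prod_def x_def atLeast0LessThan)
    ultimately show ?thesis by simp
  qed
  have of_real_adj: "complex_of_real (adj i j) = adj i j" for i j
    by (simp add: adj_def)
  have norm_sq: "cnj z * z = complex_of_real ((cmod z)\<^sup>2)" for z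
    by (metis complex_norm_square mult.commute)
  have "2 * (\<Sum>i<n. cnj (x i) * (\<Sum>j<n. reg_lap $$ (i, j) * x j))
      = 2 * (\<Sum>i<n. cnj (x i) * (\<Sum>j<n. lap $$ (i, j) * x j)) + 2 * (cnj s * s / of_nat n)"
    by (simp add: reg_lap_apply distrib_left sum.distrib s_def flip: sum_distrib_right sum_divide_distrib)
  also have "\<dots> = complex_of_real Q"
    unfolding energy_identity norm_sq complex_cnj_diff[symmetric]
    by (simp add: Q_def of_real_adj)
  finally have "complex_of_real Q = 2 * (\<Sum>i<n. cnj (x i) * (e * x i))"
    by (simp add: row)
  also have "(\<Sum>i<n. cnj (x i) * (e * x i)) = e * complex_of_real N"
    unfolding N_def of_real_sum sum_distrib_left norm_sq[symmetric]
    by (intro sum.cong) (auto simp: mult_ac)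
  finally have QN: "complex_of_real Q = e * complex_of_real (2 * N)" by simp
  have "v = 0\<^sub>v n" if "\<forall>i<n. x i = 0"
    using that v(1) by (intro eq_vecI) (auto simp: x_def)
  then obtain i0 where i0: "i0 < n" "x i0 \<noteq> 0"
    using v(2) by blast
  have "N > 0"
    unfolding N_def by (rule sum_pos2[of _ i0]) (use i0 in auto)
  have adj0: "0 \<le> adj i j * (cmod (x i - x j))\<^sup>2" for i j by (simp add: adj_def)
  have "Q \<noteq> 0"
  proof
    assume "Q = 0"
    moreover have "(\<Sum>i<n. \<Sum>j<n. adj i j * (cmod (x i - x j))\<^sup>2) \<ge> 0"
      by (intro sum_nonneg adj0)
    moreover have "2 * (cmod s)\<^sup>2 / n \<ge> 0" by simp
    ultimately have Q0: "(\<Sum>i<n. \<Sum>j<n. adj i j * (cmod (x i - x j))\<^sup>2) = 0"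
      and "2 * (cmod s)\<^sup>2 / n = 0" unfolding Q_def by linarith+
    hence s0: "s = 0" using n_pos by simp
    have "x a = x b" if "E a b" for a b
    proof -
      have "a < n" "b < n" using that E_less E_sym by blast+
      hence "adj a b * (cmod (x a - x b))\<^sup>2 = 0"
        using Q0 by (simp add: sum_nonneg_eq_0_iff sum_nonneg adj0)
      thus ?thesis using that by (simp add: adj_def)
    qed
    note const = this
    have "x j = x i0" if j: "j < n" for j
    proof -
      obtain xs where "path_between E j xs i0"
        using E_connected[OF j i0(1)] by blast
      thus ?thesis by (rule constant_along_path) (rule const)
    qed
    hence "s = (\<Sum>j<n. x i0)"
      unfolding s_def by (intro sum.cong[OF refl]) (blast dest: lessThan_iff[THEN iffD1])
    hence "s = of_nat n * x i0" by simp
    thus False using s0 i0 n_pos by simp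
  qed
  moreover have "Q \<ge> 0" unfolding Q_def by (intro add_nonneg_nonneg sum_nonneg adj0) auto
  ultimately have "Q / (2 * N) > 0" using \<open>N > 0\<close> by simp
  moreover have "e = complex_of_real (Q / (2 * N))"
  proof -
    have "complex_of_real (2 * N) \<noteq> 0"
      using \<open>N > 0\<close> by (simp only: of_real_eq_0_iff)
    hence "e = complex_of_real Q / complex_of_real (2 * N)"
      unfolding QN by (rule nonzero_mult_div_cancel_right[symmetric])
    thus ?thesis by (simp only: of_real_divide)
  qed
  ultimately show ?thesis by (intro exI[of _ "Q / (2 * N)"] conjI)
qed

lemma reg_lap_char_poly_factorized:
  obtains es where "char_poly (reg_lap :: real mat) = (\<Prod>e\<leftarrow>es. [:- e, 1:])"
    and "length es = n" and "\<forall>e\<in>set es. e > 0"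
proof -
  obtain as where as: "char_poly (reg_lap :: complex mat) = (\<Prod>a\<leftarrow>as. [:- a, 1:])" "length as = n"
    using char_poly_factorized[OF reg_lap_carrier] by blast
  have pos: "\<exists>r>0. a = complex_of_real r" if "a \<in> set as" for a
  proof (rule reg_lap_eigenvalue_pos)
    have "poly (char_poly reg_lap) a = 0"
      unfolding as poly_linear_factors using that by (force simp: prod_list_zero_iff)
    thus "eigenvalue reg_lap a" using eigenvalue_root_char_poly[OF reg_lap_carrier] by blast
  qed
  define es where "es = map Re as"
  have as_es: "as = map complex_of_real es"
    unfolding es_def map_map by (rule map_idI[symmetric]) (use pos in force)
  have "\<forall>e\<in>set es. e > 0"
    using pos by (force simp: es_def)
  have "poly (char_poly (reg_lap :: real mat)) x = poly (\<Prod>e\<leftarrow>es. [:- e, 1:]) x" for x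
  proof -
    have "complex_of_real (poly (char_poly reg_lap) x)
        = poly (char_poly (map_mat complex_of_real reg_lap)) (complex_of_real x)"
      by (simp add: of_real_hom.char_poly_hom[OF reg_lap_carrier])
    also have "\<dots> = (\<Prod>a\<leftarrow>as. complex_of_real x - a)"
      by (simp add: map_mat_of_real_reg_lap as poly_linear_factors)
    also have "\<dots> = complex_of_real (poly (\<Prod>e\<leftarrow>es. [:- e, 1:]) x)"
      unfolding as_es poly_linear_factors of_real_hom.hom_prod_list by (simp add: o_def)
    finally show ?thesis by (simp only: of_real_eq_iff)
  qed
  hence "char_poly (reg_lap :: real mat) = (\<Prod>e\<leftarrow>es. [:- e, 1:])"
    by (simp only: poly_eq_poly_eq_iff[symmetric] fun_eq_iff) blast
  moreover have "length es = n" using as(2) by (simp add: es_def)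
  ultimately show ?thesis using that \<open>\<forall>e\<in>set es. e > 0\<close> by blast
qed

end

section \<open>Effective resistance\<close>

locale resistance_graph = connected_index_graph +
  fixes M :: "real mat"
  assumes M_carrier: "M \<in> carrier_mat n n"
    and reg_lap_M: "reg_lap * M = 1\<^sub>m n"
begin

lemma reg_lap_M_entry:
  assumes "i < n" "j < n"
  shows "(\<Sum>k<n. reg_lap $$ (i, k) * M $$ (k, j)) = of_bool (i = j)"
proof -
  have K: "(reg_lap :: real mat) \<in> carrier_mat n n" by simp
  have "(reg_lap * M) $$ (i, j) = (\<Sum>k<n. reg_lap $$ (i, k) * M $$ (k, j))"
    using assms M_carrier carrier_matD[OF K] by (simp add: scalar_prod_def atLeast0LessThan)
  moreover have "(reg_lap * M) $$ (i, j) = of_bool (i = j)"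
    using assms by (simp add: reg_lap_M)
  ultimately show ?thesis by simp
qed

lemma lap_commute: "i < n \<Longrightarrow> j < n \<Longrightarrow> lap $$ (i, j) = lap $$ (j, i)"
  by (auto simp: lap_def adj_commute)

text \<open>
  The columns of \<open>K\<close> sum to \<open>1\<close>, that is, the all-ones row vector is fixed by \<open>K\<close>, hence also by its
  inverse.
\<close>

lemma M_col_sum:
  assumes j: "j < n"
  shows "(\<Sum>k<n. M $$ (k, j)) = 1"
proof -
  have col: "(\<Sum>i<n. reg_lap $$ (i, k)) = (1 :: real)" if "k < n" for k
  proof -
    have "(\<Sum>i<n. reg_lap $$ (i, k)) = (\<Sum>i<n. lap $$ (k, i) + 1 / real n)"
      using that by (intro sum.cong) (auto simp: reg_lap_entry lap_commute)
    moreover have "(\<Sum>i<n. lap $$ (k, i)) = (0 :: real)"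
      by (rule lap_row_sum[OF that])
    ultimately show ?thesis using n_pos by (simp add: sum.distrib)
  qed
  have "(\<Sum>k<n. M $$ (k, j)) = (\<Sum>k<n. (\<Sum>i<n. reg_lap $$ (i, k)) * M $$ (k, j))"
    using col by simp
  also have "\<dots> = (\<Sum>i<n. \<Sum>k<n. reg_lap $$ (i, k) * M $$ (k, j))"
    unfolding sum_distrib_right by (rule sum.swap)
  also have "\<dots> = (\<Sum>i<n. of_bool (i = j))"
    using j by (simp add: reg_lap_M_entry)
  also have "\<dots> = 1" using j by simp
  finally show ?thesis .
qed

lemma lap_M_entry:
  assumes "i < n" "j < n"
  shows "(\<Sum>k<n. lap $$ (i, k) * M $$ (k, j)) = of_bool (i = j) - 1 / real n"
  using reg_lap_M_entry[OF assms] assms by (simp add: reg_lap_apply M_col_sum)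

text \<open>
  The quadratic form of \<open>M\<close> at the difference of the unit vectors of \<open>i\<close> and \<open>j\<close>. The summand by
  which \<open>M\<close> differs from the pseudoinverse of the Laplacian is a multiple of \<open>J\<close> and cancels here.
\<close>

definition resistance :: "nat \<Rightarrow> nat \<Rightarrow> real" where
  "resistance i j = M $$ (i, i) - M $$ (i, j) - M $$ (j, i) + M $$ (j, j)"

text \<open>
  Let \<open>f\<close> be the potential of a unit current from \<open>i\<close> to \<open>j\<close>. The resistance \<open>r = f i - f j\<close> equals the
  dissipated energy, the sum of the squared potential drops over all edges. Along the path the drops
  add up to \<open>r\<close>, and each drop \<open>t\<close> is at most \<open>(1 + (max 0 t)\<^sup>2) / 2\<close>. The arcs of the path being
  distinct, the squares add up to at most the energy, so \<open>r \<le> (k + r) / 2\<close> for a path with \<open>k\<close> arcs.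
\<close>

lemma resistance_le_path_length:
  assumes ij: "i < n" "j < n" and path: "path_between E i xs j"
  shows "resistance i j \<le> real (length xs - 1)"
proof -
  define f where "f k = M $$ (k, i) - M $$ (k, j)" for k
  \<comment> \<open>Of the two arcs of an edge at most the downhill one has a nonzero \<open>D\<close>, so summing \<open>D\<close> over all arcs counts every edge once.\<close>
  define D where "D a b = (max 0 (f a - f b))\<^sup>2" for a b
  let ?arcs = "set (zip xs (tl xs))"
  have res: "resistance i j = f i - f j"
    by (simp add: resistance_def f_def)
  have lap_f: "(\<Sum>l<n. lap $$ (k, l) * f l) = of_bool (k = i) - of_bool (k = j)" if "k < n" for k
    using lap_M_entry[OF that ij(1)] lap_M_entry[OF that ij(2)]
    by (simp add: f_def right_diff_distrib sum_subtractf)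
  have "2 * (f i - f j) = 2 * (\<Sum>k<n. f k * (\<Sum>l<n. lap $$ (k, l) * f l))"
    using ij by (simp add: lap_f right_diff_distrib sum_subtractf)
  also have "\<dots> = (\<Sum>a<n. \<Sum>b<n. adj a b * ((f a - f b) * (f a - f b)))"
    by (rule energy_identity)
  also have "\<dots> = (\<Sum>a<n. \<Sum>b<n. adj a b * D a b) + (\<Sum>a<n. \<Sum>b<n. adj a b * D b a)"
    unfolding sum.distrib[symmetric]
    by (intro sum.cong refl) (auto simp: D_def max_def power2_eq_square algebra_simps)
  also have "(\<Sum>a<n. \<Sum>b<n. adj a b * D b a) = (\<Sum>a<n. \<Sum>b<n. adj a b * D a b)"
    by (rule sum_adj_swap[symmetric])
  finally have energy: "f i - f j = (\<Sum>a<n. \<Sum>b<n. adj a b * D a b)" by simp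
  have arcs: "a < n \<and> b < n \<and> E a b" if "(a, b) \<in> ?arcs" for a b
    using path that successively_imp_adjacent[of E xs a b] E_less E_sym
    by (auto simp: path_between_def)
  have dist: "distinct (zip xs (tl xs))"
    using path by (intro distinct_zipI1) (simp add: path_between_def)
  have "f i - f j = (\<Sum>(a, b)\<leftarrow>zip xs (tl xs). f a - f b)"
    using path by (subst sum_list_path_differences) (auto simp: path_between_def)
  also have "\<dots> = (\<Sum>(a, b)\<in>?arcs. f a - f b)"
    by (rule sum_list_distinct_conv_sum_set[OF dist])
  also have "\<dots> \<le> (\<Sum>(a, b)\<in>?arcs. (1 + D a b) / 2)"
  proof (rule sum_mono, clarify)
    fix a b
    have "2 * max 0 (f a - f b) \<le> 1 + D a b"
      using sum_squares_bound[of 1 "max 0 (f a - f b)"] by (simp add: D_def)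
    moreover have "f a - f b \<le> max 0 (f a - f b)" by simp
    ultimately show "f a - f b \<le> (1 + D a b) / 2"
      unfolding le_divide_eq_numeral1 by argo
  qed
  also have "\<dots> = (real (length xs - 1) + (\<Sum>(a, b)\<in>?arcs. D a b)) / 2"
    using distinct_card[OF dist]
    by (simp add: case_prod_unfold sum.distrib flip: sum_divide_distrib)
  also have "(\<Sum>(a, b)\<in>?arcs. D a b) = (\<Sum>(a, b)\<in>?arcs. adj a b * D a b)"
    by (intro sum.cong) (auto simp: adj_def dest: arcs)
  also have "\<dots> \<le> (\<Sum>(a, b)\<in>{..<n} \<times> {..<n}. adj a b * D a b)"
    by (rule sum_mono2) (auto simp: adj_def D_def dest: arcs)
  also have "\<dots> = f i - f j"
    unfolding energy by (simp add: sum.cartesian_product)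
  finally show ?thesis unfolding res by simp
qed

lemma sum_resistance: "(\<Sum>i<n. \<Sum>j<n. resistance i j) = 2 * real n * mat_trace M - 2 * real n"
proof -
  have 1: "(\<Sum>i<n. \<Sum>j<n. M $$ (j, i)) = real n"
    by (simp add: M_col_sum)
  hence 2: "(\<Sum>i<n. \<Sum>j<n. M $$ (i, j)) = real n"
    by (subst sum.swap)
  have tr: "mat_trace M = (\<Sum>i<n. M $$ (i, i))"
    using M_carrier by (simp add: mat_trace_def)
  show ?thesis
    unfolding resistance_def tr sum.distrib sum_subtractf 1 2 by (simp flip: sum_distrib_left)
qed

text \<open>
  Foster's theorem: by symmetry the sum is twice the trace of \<open>L M\<close>, and \<open>L M = I - J / n\<close>.
\<close>

lemma sum_adjacent_resistance:
  "(\<Sum>i<n. \<Sum>j<n. adj i j * resistance i j) = 2 * (real n - 1)"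
proof -
  have "(\<Sum>i<n. \<Sum>j<n. adj i j * resistance i j)
      = (\<Sum>i<n. \<Sum>j<n. adj i j * (M $$ (i, i) - M $$ (j, i)))
        + (\<Sum>i<n. \<Sum>j<n. adj i j * (M $$ (j, j) - M $$ (i, j)))"
    unfolding sum.distrib[symmetric]
    by (intro sum.cong refl) (simp add: resistance_def algebra_simps)
  also have "(\<Sum>i<n. \<Sum>j<n. adj i j * (M $$ (j, j) - M $$ (i, j)))
      = (\<Sum>i<n. \<Sum>j<n. adj i j * (M $$ (i, i) - M $$ (j, i)))"
    by (rule sum_adj_swap)
  also have "(\<Sum>i<n. \<Sum>j<n. adj i j * (M $$ (i, i) - M $$ (j, i)))
      = (\<Sum>i<n. \<Sum>j<n. lap $$ (i, j) * M $$ (j, i))"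
    by (rule sum.cong[OF refl]) (simp add: lap_apply)
  also have "\<dots> = (\<Sum>i<n. 1 - 1 / real n)"
    by (intro sum.cong refl) (simp add: lap_M_entry)
  also have "\<dots> = real n - 1"
    using n_pos by (simp add: field_simps)
  finally show ?thesis by simp
qed

text \<open>
  Removing the adjacent pairs from the total resistance leaves the distinct nonadjacent ones, each of
  which contributes at most \<open>d\<close>.
\<close>

lemma trace_bound:
  assumes short: "\<And>i j. i < n \<Longrightarrow> j < n \<Longrightarrow> \<exists>xs. path_between E i xs j \<and> real (length xs - 1) \<le> d"
  defines "W \<equiv> (\<Sum>i<n. \<Sum>j<n. adj i j :: real)"
  shows "2 * real n * (mat_trace M - 1) - 2 * (real n - 1) \<le> d * (real n * (real n - 1) - W)"
proof -
  have le: "(1 - of_bool (i = j) - adj i j) * resistance i j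
      \<le> (1 - of_bool (i = j) - adj i j) * d" if "i < n" "j < n" for i j
  proof (rule mult_left_mono)
    obtain xs where "path_between E i xs j" "real (length xs - 1) \<le> d"
      using short \<open>i < n\<close> \<open>j < n\<close> by blast
    thus "resistance i j \<le> d"
      using resistance_le_path_length[of i j xs] that by linarith
  qed (auto simp: adj_def E_irrefl)
  have diag: "resistance i i = 0" for i
    by (simp add: resistance_def)
  have "2 * real n * (mat_trace M - 1) - 2 * (real n - 1)
      = (\<Sum>i<n. \<Sum>j<n. (1 - of_bool (i = j) - adj i j) * resistance i j)"
    by (simp add: left_diff_distrib sum_subtractf sum_resistance sum_adjacent_resistance diag
        algebra_simps)
  also have "\<dots> \<le> (\<Sum>i<n. \<Sum>j<n. (1 - of_bool (i = j) - adj i j) * d)"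
    by (intro sum_mono le) auto
  also have "\<dots> = (\<Sum>i<n. \<Sum>j<n. 1 - of_bool (i = j) - adj i j) * d"
    by (simp only: sum_distrib_right)
  also have "(\<Sum>i<n. \<Sum>j<n. 1 - of_bool (i = j) - adj i j) = real n * (real n - 1) - W"
    by (simp add: W_def sum_subtractf algebra_simps)
  finally show ?thesis by (simp only: mult.commute)
qed

end

section \<open>The performance measure and its bounds\<close>

text \<open>
  Cauchy--Schwarz for \<open>sqrt x\<close> and \<open>1 / sqrt x\<close>. Square roots are avoided by summing the tangent
  bound \<open>1 / x \<ge> 2 t - t\<^sup>2 x\<close> at the point \<open>1 / t\<close> that is the mean of the list.
\<close>

lemma sum_list_mult_sum_list_reciprocals_ge:
  fixes xs :: "real list"
  assumes "\<forall>x\<in>set xs. x > 0"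
  shows "(real (length xs))\<^sup>2 \<le> sum_list xs * (\<Sum>x\<leftarrow>xs. 1 / x)"
proof (cases "xs = []")
  case False
  define t where "t = real (length xs) / sum_list xs"
  have pos: "sum_list xs > 0"
    using assms False by (cases xs) (auto intro!: add_pos_nonneg sum_list_nonneg simp: less_imp_le)
  have "2 * t - t\<^sup>2 * x \<le> 1 / x" if "x \<in> set xs" for x
  proof -
    have "0 \<le> (1 - t * x)\<^sup>2 / x" using assms that by (intro divide_nonneg_pos) auto
    also have "\<dots> = 1 / x - (2 * t - t\<^sup>2 * x)"
      using assms that by (auto simp: power2_eq_square field_simps)
    finally show ?thesis by simp
  qed
  hence "(\<Sum>x\<leftarrow>xs. 2 * t - t\<^sup>2 * x) \<le> (\<Sum>x\<leftarrow>xs. 1 / x)"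
    by (rule sum_list_mono)
  moreover have "(\<Sum>x\<leftarrow>xs. 2 * t - t\<^sup>2 * x) = 2 * t * real (length xs) - t\<^sup>2 * sum_list xs"
    by (induction xs) (auto simp: algebra_simps)
  ultimately have "sum_list xs * (2 * t * real (length xs) - t\<^sup>2 * sum_list xs)
      \<le> sum_list xs * (\<Sum>x\<leftarrow>xs. 1 / x)"
    using pos by (intro mult_left_mono) auto
  moreover have "sum_list xs * (2 * t * real (length xs) - t\<^sup>2 * sum_list xs) = (real (length xs))\<^sup>2"
    using pos by (simp add: t_def power2_eq_square field_simps)
  ultimately show ?thesis by simp
qed simp

lemma sum_list_map_sort:
  "sum_list (map f (sort xs)) = (sum_list (map f xs) :: 'a :: comm_monoid_add)"
  by (metis mset_map mset_sort sum_mset_sum_list)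

context connected_index_graph
begin

text \<open>
  The positive spectrum of \<open>K\<close> is transferred to \<open>L\<close> by exchanging one root \<open>1\<close> for the root \<open>0\<close>. This
  also shows that \<open>0\<close> is a simple root, which is where connectedness enters the spectrum.
\<close>

lemma lap_spectrum:
  obtains es where "char_poly (lap :: real mat) = [:0, 1:] * (\<Prod>e\<leftarrow>es. [:- e, 1:])"
    and "length es = n - 1" and "\<forall>e\<in>set es. e > 0"
    and "char_poly (reg_lap :: real mat) = (\<Prod>e\<leftarrow>1 # es. [:- e, 1:])"
proof -
  obtain fs where fs: "char_poly (reg_lap :: real mat) = (\<Prod>e\<leftarrow>fs. [:- e, 1:])"
    "length fs = n" "\<forall>e\<in>set fs. e > 0"
    by (rule reg_lap_char_poly_factorized)
  have shift: "[:0, 1:] * char_poly (reg_lap :: real mat) = [:- 1, 1:] * char_poly lap"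
    unfolding reg_lap_def using n_pos lap_row_sum by (intro char_poly_add_averaging) auto
  from arg_cong[OF this, of "\<lambda>p. poly p 1"] have "poly (char_poly (reg_lap :: real mat)) 1 = 0"
    by simp
  hence "1 \<in> set fs"
    unfolding fs(1) poly_linear_factors by (force simp: prod_list_zero_iff)
  define es where "es = remove1 1 fs"
  have cp: "char_poly (reg_lap :: real mat) = (\<Prod>e\<leftarrow>1 # es. [:- e, 1:])"
    unfolding fs(1) es_def using prod_list_map_remove1[OF \<open>1 \<in> set fs\<close>, of "\<lambda>e. [:- e, 1:]"] by simp
  have "[:- 1, 1:] * char_poly (lap :: real mat) = [:- 1, 1:] * ([:0, 1:] * (\<Prod>e\<leftarrow>es. [:- e, 1:]))"
    unfolding shift[symmetric] cp by (simp only: list.map prod_list.Cons mult_ac)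
  hence "char_poly (lap :: real mat) = [:0, 1:] * (\<Prod>e\<leftarrow>es. [:- e, 1:])"
    by (subst (asm) mult_left_cancel) auto
  moreover have "length es = n - 1"
    using \<open>1 \<in> set fs\<close> fs(2) by (simp add: es_def length_remove1)
  moreover have "\<forall>e\<in>set es. e > 0"
    using fs(3) set_remove1_subset[of 1 fs] by (auto simp: es_def)
  ultimately show ?thesis using cp by (rule that)
qed

lemma sorted_eigenvalues_lap:
  assumes cp: "char_poly (lap :: real mat) = [:0, 1:] * (\<Prod>e\<leftarrow>es. [:- e, 1:])"
    and pos: "\<forall>e\<in>set es. e > 0"
  shows "sorted_eigenvalues lap = 0 # sort es"
proof -
  have nz: "(\<Prod>e\<leftarrow>es. [:- e, 1:]) \<noteq> 0"
    by (auto simp: prod_list_zero_iff)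
  have "proots (\<Prod>e\<leftarrow>es. [:- e, 1:]) = mset es"
  proof (induction es)
    case (Cons e es)
    have "proots ([:- e, 1:] * (\<Prod>e\<leftarrow>es. [:- e, 1:])) = add_mset e (mset es)"
      by (subst proots_mult) (auto simp: prod_list_zero_iff Cons.IH)
    thus ?case by simp
  qed simp
  hence "proots (char_poly (lap :: real mat)) = mset (0 # es)"
    unfolding cp using nz by (subst proots_mult) auto
  hence "sorted_eigenvalues lap = insort 0 (sort es)"
    unfolding sorted_eigenvalues_def by (simp add: sorted_list_of_multiset_mset)
  also have "\<dots> = 0 # sort es"
    using pos by (intro insort_is_Cons) (auto simp: less_imp_le)
  finally show ?thesis .
qed

lemma rho_ss_centered_lap:
  assumes cp: "char_poly (lap :: real mat) = [:0, 1:] * (\<Prod>e\<leftarrow>es. [:- e, 1:])"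
    and pos: "\<forall>e\<in>set es. e > 0" and len: "length es = n - 1"
  shows "rho_ss_centered lap = 1 / 2 * (\<Sum>e\<leftarrow>es. 1 / e)"
proof -
  have dim: "dim_row (lap :: real mat) = n" by (simp add: lap_def)
  have "(\<Sum>i = 1..<n. 1 / (0 # sort es) ! i) = (\<Sum>i<n - 1. 1 / sort es ! i)"
    using n_pos sum.shift_bounds_nat_ivl[of "\<lambda>i. 1 / (0 # sort es) ! i" 0 1 "n - 1"]
    by (simp add: atLeast0LessThan)
  also have "\<dots> = (\<Sum>e\<leftarrow>sort es. 1 / e)"
    using len by (simp add: sum_list_sum_nth atLeast0LessThan)
  also have "\<dots> = (\<Sum>e\<leftarrow>es. 1 / e)"
    by (rule sum_list_map_sort)
  finally show ?thesis
    unfolding rho_ss_centered_def sorted_eigenvalues_lap[OF cp pos] dim by simp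
qed

lemma trace_reg_lap: "mat_trace (reg_lap :: real mat) = (\<Sum>i<n. \<Sum>j<n. adj i j) + 1"
proof -
  have "mat_trace (reg_lap :: real mat) = (\<Sum>i<n. (\<Sum>j<n. adj i j) + 1 / real n)"
    using carrier_matD(1)[OF reg_lap_carrier] unfolding mat_trace_def
    by (intro sum.cong) (auto simp: reg_lap_entry lap_def adj_def E_irrefl)
  thus ?thesis using n_pos by (simp add: sum.distrib)
qed

lemma rho_bounds:
  fixes d :: real
  defines "W \<equiv> (\<Sum>i<n. \<Sum>j<n. adj i j :: real)"
  assumes n2: "n \<ge> 2" and d: "d > 0"
    and short: "\<And>i j. i < n \<Longrightarrow> j < n \<Longrightarrow> \<exists>xs. path_between E i xs j \<and> real (length xs - 1) \<le> d"
  shows "(real n - 1)\<^sup>2 / 2 \<le> rho_ss_centered lap * W"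
    and "(rho_ss_centered lap - 1 / 2 + 1 / (2 * real n)) / d + W / (4 * (real n - 1)) \<le> real n / 4"
proof -
  obtain es where cpL: "char_poly (lap :: real mat) = [:0, 1:] * (\<Prod>e\<leftarrow>es. [:- e, 1:])"
    and len: "length es = n - 1" and pos: "\<forall>e\<in>set es. e > 0"
    and cpK: "char_poly (reg_lap :: real mat) = (\<Prod>e\<leftarrow>1 # es. [:- e, 1:])"
    by (rule lap_spectrum)
  have K: "(reg_lap :: real mat) \<in> carrier_mat n n" by simp
  have rho: "rho_ss_centered lap = 1 / 2 * (\<Sum>e\<leftarrow>es. 1 / e)"
    by (rule rho_ss_centered_lap[OF cpL pos len])
  have W: "W = sum_list es"
    using mat_trace_eq_sum_list_roots[OF K cpK] trace_reg_lap by (simp add: W_def)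
  have "(real n - 1)\<^sup>2 \<le> W * (\<Sum>e\<leftarrow>es. 1 / e)"
    using sum_list_mult_sum_list_reciprocals_ge[OF pos] n2 by (simp add: W len of_nat_diff)
  thus "(real n - 1)\<^sup>2 / 2 \<le> rho_ss_centered lap * W"
    by (simp add: rho mult_ac)
  have nz: "0 \<notin> set (1 # es)" using pos by auto
  have "det (reg_lap :: real mat) \<noteq> 0"
  proof
    assume "det (reg_lap :: real mat) = 0"
    moreover have "char_matrix (reg_lap :: real mat) 0 = reg_lap"
      by (rule eq_matI) (auto simp: char_matrix_def carrier_matD[OF K])
    ultimately have "poly (char_poly (reg_lap :: real mat)) 0 = 0"
      by (simp add: eigenvalue_root_char_poly[OF K, symmetric] eigenvalue_det[OF K])
    thus False
      unfolding cpK poly_linear_factors using nz by (force simp: prod_list_zero_iff)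
  qed
  then obtain M :: "real mat" where M: "M \<in> carrier_mat n n" "reg_lap * M = 1\<^sub>m n"
    using det_non_zero_imp_unit[OF K, of "()"] by (auto simp: Units_def ring_mat_def)
  interpret resistance_graph n E M
    by unfold_locales (use M in auto)
  have "mat_trace M = (\<Sum>e\<leftarrow>1 # es. 1 / e)"
  proof -
    have "char_poly M = (\<Prod>e\<leftarrow>map (\<lambda>e. 1 / e) (1 # es). [:- e, 1:])"
      using char_poly_inverse[OF K M cpK nz] by (simp add: o_def)
    from mat_trace_eq_sum_list_roots[OF M(1) this] show ?thesis .
  qed
  hence tr: "mat_trace M - 1 = 2 * rho_ss_centered lap" by (simp add: rho)
  have "4 * real n * (rho_ss_centered lap - 1 / 2 + 1 / (2 * real n))
      = 2 * real n * (mat_trace M - 1) - 2 * (real n - 1)"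
    using n2 by (simp add: tr field_simps)
  also have "\<dots> \<le> d * (real n * (real n - 1) - W)"
    unfolding W_def by (rule trace_bound[OF short])
  finally have bound: "(rho_ss_centered lap - 1 / 2 + 1 / (2 * real n)) / d
      \<le> (real n * (real n - 1) - W) / (4 * real n)"
    using n2 d by (simp add: field_simps)
  have "W \<le> (\<Sum>i<n. \<Sum>j<n. 1 - of_bool (i = j))"
    unfolding W_def by (intro sum_mono) (auto simp: adj_def E_irrefl)
  hence "0 \<le> real n * (real n - 1) - W"
    by (simp add: sum_subtractf algebra_simps)
  \<comment> \<open>The bound on nonadjacent pairs has denominator \<open>4 n\<close>; a nonnegative number of pairs allows the smaller \<open>4 (n - 1)\<close>.\<close>
  hence "(real n * (real n - 1) - W) / (4 * real n) \<le> (real n * (real n - 1) - W) / (4 * (real n - 1))"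
    using n2 by (intro divide_left_mono) auto
  also have "\<dots> = real n / 4 - W / (4 * (real n - 1))"
    using n2 by (simp add: field_simps)
  finally show "(rho_ss_centered lap - 1 / 2 + 1 / (2 * real n)) / d + W / (4 * (real n - 1)) \<le> real n / 4"
    using bound by linarith
qed

end

section \<open>Transfer to digraphs with enumerated nodes\<close>

lemma (in wf_digraph) successively_dominates_awalk_verts:
  "awalk u p v \<Longrightarrow> successively (\<lambda>a b. a \<rightarrow>\<^bsub>G\<^esub> b) (awalk_verts u p)"
proof (induction p arbitrary: u)
  case (Cons e p)
  hence "awalk (head G e) p v" and e: "e \<in> arcs G" "u = tail G e"
    by (auto simp: awalk_Cons_iff)
  moreover have "awhd (head G e) p = head G e"
    using \<open>awalk (head G e) p v\<close> by simp
  ultimately show ?case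
    using Cons.IH[of "head G e"] by (auto simp: successively_Cons in_arcs_imp_in_arcs_ends)
qed simp

lemma (in nomulti_digraph) out_degree_eq_card_dominated:
  "out_degree G u = card {v. u \<rightarrow>\<^bsub>G\<^esub> v}"
proof -
  have "inj_on (head G) (out_arcs G u)"
    by (rule inj_onI) (auto intro!: no_multi_arcs simp: arc_to_ends_def)
  moreover have "head G ` out_arcs G u = {v. u \<rightarrow>\<^bsub>G\<^esub> v}"
    by (auto simp: arcs_ends_conv image_iff)
  ultimately show ?thesis
    unfolding out_degree_def by (metis card_image)
qed

theorem corollary1:
  fixes G :: "('a, 'b) pre_digraph" and vs :: "'a list" and n :: nat
  assumes "graph G"
    and "connected G"
    and "distinct vs" and "set vs = verts G"
    and "card (verts G) = n" and "n \<ge> 2"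
  shows "rho_ss_centered (laplacian_mat G vs) * real (num_nonzero_entries (adjacency_mat G vs))
           \<ge> (real n - 1)\<^sup>2 / 2
       \<and> (rho_ss_centered (laplacian_mat G vs) - 1 / 2 + 1 / (2 * real n)) / diameter G
           + real (num_nonzero_entries (adjacency_mat G vs)) / (4 * (real n - 1))
           \<le> real n / 4"
proof -
  interpret graph G by fact
  have len: "length vs = n"
    using distinct_card[OF assms(3)] assms(4,5) by simp
  have nth_verts: "vs ! i \<in> verts G" if "i < n" for i
    using that len assms(4) nth_mem by blast
  define E where "E i j \<longleftrightarrow> i < n \<and> j < n \<and> vs ! i \<rightarrow>\<^bsub>G\<^esub> vs ! j" for i j
  define idx where "idx = inv_into {..<n} ((!) vs)"
  have bij: "bij_betw ((!) vs) {..<n} (verts G)"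
    using assms(3,4) len by (intro bij_betw_nth) auto
  have idx_nth: "idx (vs ! i) = i" if "i < n" for i
    unfolding idx_def using bij that by (intro inv_into_f_f) (auto simp: bij_betw_def)
  have nth_idx: "vs ! idx v = v" and idx_less: "idx v < n" if "v \<in> verts G" for v
    using bij that f_inv_into_f[of v "(!) vs" "{..<n}"] inv_into_into[of v "(!) vs" "{..<n}"]
    by (auto simp: bij_betw_def idx_def)

  \<comment> \<open>Distances are attained by paths, which are carried over to indices along the bijection \<open>idx\<close>.\<close>
  have dist: "\<exists>xs. path_between E i xs j \<and> graph_distance G (vs ! i) (vs ! j) = ereal (real (length xs - 1))"
    if ij: "i < n" "j < n" for i j
  proof -
    have "strongly_connected G"
      using symmetric_connected_imp_strongly_connected[OF sym_arcs assms(2)] .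
    hence "vs ! i \<rightarrow>\<^sup>*\<^bsub>G\<^esub> vs ! j"
      using ij nth_verts by (auto simp: strongly_connected_def)
    then obtain p where p: "apath (vs ! i) p (vs ! j)"
      "\<mu> (\<lambda>_. 1) (vs ! i) (vs ! j) = ereal (awalk_cost (\<lambda>_. 1) p)"
      using min_cost_awalk[of "vs ! i" "vs ! j" "\<lambda>_. 1"] by auto
    let ?ws = "awalk_verts (vs ! i) p"
    have walk: "awalk (vs ! i) p (vs ! j)" and dw: "distinct ?ws"
      using p(1) by (simp_all add: apath_def)
    have ws: "set ?ws \<subseteq> verts G" using walk by (rule awalkE)
    have "path_between E i (map idx ?ws) j"
      unfolding path_between_def
    proof (intro conjI)
      show "distinct (map idx ?ws)"
        using dw ws nth_idx by (auto simp: distinct_map intro!: inj_on_inverseI[of _ "(!) vs"])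
      show "successively E (map idx ?ws)"
        unfolding successively_map
        by (rule successively_mono[OF successively_dominates_awalk_verts[OF walk]])
          (use ws nth_idx idx_less in \<open>auto simp: E_def subset_iff\<close>)
    qed (use walk ij in \<open>auto simp: hd_map last_map idx_nth\<close>)
    moreover have "awalk_cost (\<lambda>_. 1) p = real (length (map idx ?ws) - 1)"
      by (simp add: awalk_cost_def length_awalk_verts sum_list_triv)
    ultimately show ?thesis
      using p(2) by (auto simp: graph_distance_def)
  qed

  interpret connected_index_graph n E
  proof
    show "n > 0" using assms(6) by simp
    show "E i j \<Longrightarrow> E j i" for i j
      using arcs_ends_symmetric[OF sym_arcs] by (auto simp: E_def)
    show "\<not> E i i" for i
      using adj_not_same by (auto simp: E_def)
    show "\<exists>xs. path_between E i xs j" if "i < n" "j < n" for i j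
      using dist[OF that] by blast
  qed (auto simp: E_def)

  let ?dists = "(\<lambda>(u, v). graph_distance G u v) ` (verts G \<times> verts G)"
  have "Max ?dists \<in> ?dists"
    using assms(5,6) by (intro Max_in) (auto simp: card_eq_0_iff)
  then obtain u v where uv: "u \<in> verts G" "v \<in> verts G" "Max ?dists = graph_distance G u v"
    by auto
  then obtain k where "graph_distance G u v = ereal k"
    using dist[OF idx_less[OF uv(1)] idx_less[OF uv(2)]] by (auto simp: nth_idx)
  hence Max_eq: "Max ?dists = ereal (diameter G)"
    by (simp add: diameter_def uv(3))
  have short: "\<exists>xs. path_between E i xs j \<and> real (length xs - 1) \<le> diameter G"
    if ij: "i < n" "j < n" for i j
  proof -
    have "graph_distance G (vs ! i) (vs ! j) \<le> Max ?dists"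
      using nth_verts ij by (intro Max_ge) auto
    moreover obtain xs where "path_between E i xs j"
      "graph_distance G (vs ! i) (vs ! j) = ereal (real (length xs - 1))"
      using dist[OF ij] by blast
    ultimately have "real (length xs - 1) \<le> diameter G" by (simp add: Max_eq)
    thus ?thesis using \<open>path_between E i xs j\<close> by blast
  qed
  \<comment> \<open>Two distinct nodes exist because \<open>n \<ge> 2\<close>, and a path between them has an arc.\<close>
  have "diameter G > 0"
  proof -
    obtain xs where xs: "path_between E 0 xs 1" "real (length xs - 1) \<le> diameter G"
      using short[of 0 1] assms(6) by auto
    have "length xs \<ge> 2"
      using xs(1) by (cases xs rule: remdups_adj.cases) (auto simp: path_between_def)
    thus ?thesis using xs(2) by linarith
  qed

  have "out_degree G (vs ! i) = card {j. E i j}" if "i < n" for i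
  proof -
    have "{w. vs ! i \<rightarrow>\<^bsub>G\<^esub> w} = (!) vs ` {j. E i j}"
      using that nth_idx idx_less adj_in_verts(2) by (force simp: E_def image_iff)
    moreover have "inj_on ((!) vs) {j. E i j}"
      using bij by (auto simp: bij_betw_def E_def intro: inj_on_subset)
    ultimately show ?thesis
      by (simp add: out_degree_eq_card_dominated card_image)
  qed
  moreover have "(\<Sum>j<n. adj i j) = real (card {j. E i j})" for i
  proof -
    have "{..<n} \<inter> {j. E i j} = {j. E i j}" by (auto simp: E_def)
    thus ?thesis by (simp add: adj_def)
  qed
  ultimately have degree: "real (out_degree G (vs ! i)) = (\<Sum>j<n. adj i j)" if "i < n" for i
    using that by simp
  have entry: "(if vs ! i \<rightarrow>\<^bsub>G\<^esub> vs ! j then 1 else 0) = (adj i j :: real)" if "i < n" "j < n" for i j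
    using that by (simp add: adj_def E_def)
  have lap: "laplacian_mat G vs = lap"
    by (rule eq_matI)
      (auto simp: laplacian_mat_def degree_mat_def adjacency_mat_def lap_def len degree entry)
  have "num_nonzero_entries (adjacency_mat G vs) = card (({..<n} \<times> {..<n}) \<inter> {p. E (fst p) (snd p)})"
    unfolding num_nonzero_entries_def
    by (rule arg_cong[where f = card]) (auto simp: adjacency_mat_def len E_def split: if_splits)
  also have "real \<dots> = (\<Sum>p\<in>{..<n} \<times> {..<n}. of_bool (E (fst p) (snd p)))"
    by simp
  also have "\<dots> = (\<Sum>i<n. \<Sum>j<n. adj i j)"
    by (simp only: adj_def sum.cartesian_product case_prod_unfold)
  finally have nnz: "real (num_nonzero_entries (adjacency_mat G vs)) = (\<Sum>i<n. \<Sum>j<n. adj i j)" .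
  show ?thesis
    unfolding lap nnz using rho_bounds[OF assms(6) \<open>diameter G > 0\<close> short] by blast
qed

end
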